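(* Let $p$ be a prime, let $s\ge 1$ be an integer, and let $G=(\mathbb{Z}/p\mathbb{Z})^s$. Then: (i) every finite set $B$ of non-zero elements of $G$ satisfies $s(B)>\frac{2}{7}|B|$; (ii) every finite sequence $A=(a_1,\dots,a_n)$ of non-zero elements of $G$ satisfies $s(A)>\frac{2}{7}n$. Moreover, the constant $\frac{2}{7}$ is best possible in both (i) and (ii): for every constant $c>\frac{2}{7}$ there exist a prime $p$, an integer $s\ge1$ and a finite set $B$ (in particular, a sequence of distinct elements) of non-zero elements of $(\mathbb{Z}/p\mathbb{Z})^s$ with $s(B)< c|B|$.
   Context: A subset $A$ of an Abelian group is called sum-free if there are no $a_1,a_2,a_3\in A$ with $a_1+a_2=a_3$ (the case $a_1=a_2$ is not excluded). For a subset $B$ of an Abelian group, $s(B)$ denotes the maximum cardinality of a sum-free subset of $B$. For a sequence $A=(a_1,\dots,a_n)$ of (not necessarily distinct) elements of an Abelian group, $s(A)$ denotes the maximum number $k$ of terms of a subsequence $(a_{i_1},\dots,a_{i_k})$ (with $i_1<\dots<i_k$) such that there are no indices $j,l,r\in\{i_1,\dots,i_k\}$ (not necessarily distinct) with $a_j+a_l=a_r$.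
   Formalization: In (i) the set B is taken to be nonempty and in (ii) the sequence A is taken to have n ≥ 1 terms, since for the empty set or empty sequence the strict inequality would read 0 > 0. *)

theory Defs
  imports Complex_Main "HOL-Algebra.Product_Groups" "HOL-Computational_Algebra.Primes"
begin

text \<open>
  Abelian groups are written multiplicatively, as in HOL-Algebra: the mathematical
  \<open>a + b\<close> is \<open>a \<otimes>\<^bsub>G\<^esub> b\<close> and the mathematical \<open>0\<close> is \<open>\<one>\<^bsub>G\<^esub>\<close>.
\<close>

definition sum_free :: "('a, 'm) monoid_scheme \<Rightarrow> 'a set \<Rightarrow> bool" where
  "sum_free G A \<longleftrightarrow> \<not> (\<exists>a1\<in>A. \<exists>a2\<in>A. \<exists>a3\<in>A. a1 \<otimes>\<^bsub>G\<^esub> a2 = a3)"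

text \<open>Meaningful for finite \<open>B\<close>.\<close>

definition max_sum_free_set :: "('a, 'm) monoid_scheme \<Rightarrow> 'a set \<Rightarrow> nat" where
  "max_sum_free_set G B = Max {card A | A. A \<subseteq> B \<and> sum_free G A}"

text \<open>
  A subsequence of a list is represented by its set \<open>I\<close> of (zero-based) positions, so that
  repeated elements are counted with multiplicity.
\<close>

definition sum_free_indices :: "('a, 'm) monoid_scheme \<Rightarrow> 'a list \<Rightarrow> nat set \<Rightarrow> bool" where
  "sum_free_indices G as I \<longleftrightarrow> \<not> (\<exists>j\<in>I. \<exists>l\<in>I. \<exists>r\<in>I. as ! j \<otimes>\<^bsub>G\<^esub> as ! l = as ! r)"

definition max_sum_free_seq :: "('a, 'm) monoid_scheme \<Rightarrow> 'a list \<Rightarrow> nat" where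
  "max_sum_free_seq G as = Max {card I | I. I \<subseteq> {..<length as} \<and> sum_free_indices G as I}"

definition Zp_power :: "nat \<Rightarrow> nat \<Rightarrow> (nat \<Rightarrow> int) monoid" where
  "Zp_power p s = product_group {..<s} (\<lambda>_. integer_mod_group p)"

definition nonzero_elems :: "('a, 'm) monoid_scheme \<Rightarrow> 'a set" where
  "nonzero_elems G = carrier G - {\<one>\<^bsub>G\<^esub>}"

end

theory Submission
  imports Defs "HOL-Number_Theory.Cong"
begin

text \<open>
  Lower bound: for a uniformly random vector \<open>v\<close> of \<open>F\<^sub>p\<^sup>s\<close>, the residue \<open>v \<cdot> x\<close> of a non-zero
  \<open>x\<close> is uniform, so on average \<open>v\<close> sends at least \<open>2/7\<close> of the terms into the middle third of
  \<open>\<int>/p\<close>, which is sum-free; the inequality is strict because \<open>v = 0\<close> sends nothing there.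

  Sharpness: a sum-free \<open>A\<close> in \<open>F\<^sub>7\<^sup>s\<close> has density at most \<open>2/7\<close>. Otherwise the identity
  \<open>\<Sum>\<^sub>v |A^(v)|\<^sup>2 A^(v) = 0\<close> for the Fourier transform yields \<open>v \<noteq> 0\<close> with
  \<open>Re A^(v) \<le> - 2/5 |A|\<close>. Let \<open>a\<^sub>r\<close> be the density of \<open>A\<close> in the hyperplane \<open>v \<cdot> x = r\<close>. Dyson's
  transform bounds sumsets inside a hyperplane up to the size of a proper subgroup, which gives
  \<open>a\<^sub>i + a\<^sub>j + a\<^sub>i\<^sub>+\<^sub>j \<le> 8/7\<close> whenever the three densities are positive. These inequalities, the easier
  pairwise ones and the Fourier inequality form a linear system that forces \<open>\<Sum>\<^sub>r a\<^sub>r \<le> 2\<close>.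
\<close>

section \<open>Sumsets in a subgroup\<close>

context comm_group
begin

lemma stabilizer_subgroup:
  assumes K: "subgroup K G" and X: "X \<subseteq> carrier G" and fin: "finite X"
  shows "subgroup {g \<in> K. \<forall>x\<in>X. g \<otimes> x \<in> X} G"
proof (rule subgroupI)
  show "{g \<in> K. \<forall>x\<in>X. g \<otimes> x \<in> X} \<subseteq> carrier G"
    using subgroup.subset[OF K] by auto
  show "{g \<in> K. \<forall>x\<in>X. g \<otimes> x \<in> X} \<noteq> {}"
    using subgroup.one_closed[OF K] X by (auto intro!: exI[of _ \<one>] simp: subset_iff)
next
  fix g assume g: "g \<in> {g \<in> K. \<forall>x\<in>X. g \<otimes> x \<in> X}"
  then have gc: "g \<in> carrier G" using subgroup.subset[OF K] by auto
  \<comment> \<open>Finiteness of \<open>X\<close> turns translation by \<open>g\<close> into a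
    permutation of \<open>X\<close>, so its inverse preserves \<open>X\<close> as well.\<close>
  have "inj_on ((\<otimes>) g) X"
    using gc X by (auto simp: inj_on_def subset_iff)
  then have surj: "(\<otimes>) g ` X = X"
    using g fin by (intro endo_inj_surj) auto
  have "inv g \<otimes> x \<in> X" if "x \<in> X" for x
  proof -
    have "x \<in> (\<otimes>) g ` X"
      using that by (simp only: surj)
    then obtain y where y: "y \<in> X" "x = g \<otimes> y"
      by (rule imageE)
    then show ?thesis
      using gc X by (simp add: m_assoc[symmetric] subset_iff)
  qed
  then show "inv g \<in> {g \<in> K. \<forall>x\<in>X. g \<otimes> x \<in> X}"
    using g subgroup.m_inv_closed[OF K] by auto
next
  fix g h assume "g \<in> {g \<in> K. \<forall>x\<in>X. g \<otimes> x \<in> X}" "h \<in> {g \<in> K. \<forall>x\<in>X. g \<otimes> x \<in> X}"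
  then show "g \<otimes> h \<in> {g \<in> K. \<forall>x\<in>X. g \<otimes> x \<in> X}"
    using subgroup.subset[OF K] X subgroup.m_closed[OF K] by (auto simp: m_assoc subset_iff)
qed

text \<open>The translate of \<open>Y\<close> by \<open>x\<close> and the set \<open>Z\<close> are
  disjoint subsets of \<open>K\<close>.\<close>

lemma sumset_bound_shift:
  assumes K: "subgroup K G" and fin: "finite K" and "Y \<subseteq> K" and "Z \<subseteq> K" and "x \<in> K"
    and "\<And>y. y \<in> Y \<Longrightarrow> x \<otimes> y \<notin> Z"
  shows "card Y + card Z \<le> card K"
proof -
  interpret K: subgroup K G by fact
  have "finite Y" "finite Z" using assms(2-4) by (auto intro: finite_subset)
  then have "card ((\<otimes>) x ` Y \<union> Z) = card ((\<otimes>) x ` Y) + card Z"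
    using assms by (intro card_Un_disjoint) auto
  also have "card ((\<otimes>) x ` Y) = card Y"
    using assms K.subset by (intro card_image) (auto simp: inj_on_def subset_iff)
  finally show ?thesis
    using card_mono[OF fin, of "(\<otimes>) x ` Y \<union> Z"] assms by auto
qed

text \<open>A weak form of Kneser's theorem: with \<open>Z\<close> the complement in
  \<open>K\<close> of the product set of \<open>X\<close> and \<open>Y\<close>, it says that this
  product set has at least \<open>card X + card Y - m\<close> elements unless it is all of
  \<open>K\<close>. The induction replaces \<open>(X, Y)\<close> by a pair with the same total size
  and a smaller \<open>Y\<close> whose products still avoid \<open>Z\<close>; when this gets stuck,
  \<open>Y\<close> is no larger than a proper subgroup.\<close>

lemma sumset_bound:
  assumes K: "subgroup K G" and fin: "finite K"
    and m: "\<And>L. subgroup L G \<Longrightarrow> L \<subset> K \<Longrightarrow> card L \<le> m"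
    and "X \<subseteq> K" "Y \<subseteq> K" and Z: "Z \<subseteq> K" and "X \<noteq> {}" "Y \<noteq> {}" and Zne: "Z \<noteq> {}"
    and "\<And>x y. x \<in> X \<Longrightarrow> y \<in> Y \<Longrightarrow> x \<otimes> y \<notin> Z"
  shows "card X + card Y + card Z \<le> card K + m"
  using assms(4,5,7,8,10)
proof (induction "card Y" arbitrary: X Y rule: less_induct)
  case less
  note XY = less.prems
  interpret K: subgroup K G by fact
  have car: "X \<subseteq> carrier G" "Y \<subseteq> carrier G" "Z \<subseteq> carrier G"
    using XY(1,2) Z K.subset by auto
  have finXY: "finite X" "finite Y" "finite Z"
    using XY(1,2) Z fin by (auto intro: finite_subset)
  show ?case
  proof (cases "\<exists>a\<in>X. \<exists>b\<in>Y. \<exists>y\<in>Y. a \<otimes> inv b \<otimes> y \<notin> X")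
    case True
    then obtain a b y where ab: "a \<in> X" "b \<in> Y" and y: "y \<in> Y" "a \<otimes> inv b \<otimes> y \<notin> X" by auto
    txt \<open>Dyson's transform with parameter \<open>e\<close> keeps \<open>card X + card Y\<close> and shrinks \<open>Y\<close>.\<close>
    define e where "e = a \<otimes> inv b"
    have e: "e \<in> K" unfolding e_def using ab XY(1,2) by (meson K.m_closed K.m_inv_closed subsetD)
    then have ec: "e \<in> carrier G" by auto
    define X' where "X' = X \<union> (\<otimes>) e ` Y"
    define Y' where "Y' = {y \<in> Y. e \<otimes> y \<in> X}"
    have "Y' \<subset> Y" using y by (auto simp: Y'_def e_def)
    then have lt: "card Y' < card Y" using finXY by (simp add: psubset_card_mono)
    have inj: "inj_on ((\<otimes>) e) Y"
      using ec car by (auto simp: inj_on_def subset_iff)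
    have "e \<otimes> b = a" using ab car by (auto simp: e_def m_assoc subset_iff)
    \<comment> \<open>The choice of \<open>e\<close> moves \<open>b\<close> to \<open>a\<close>,
      which keeps \<open>Y'\<close> non-empty for the induction.\<close>
    then have "b \<in> Y'" using ab by (simp add: Y'_def)
    have "card X' + card (X \<inter> (\<otimes>) e ` Y) = card X + card ((\<otimes>) e ` Y)"
      unfolding X'_def using finXY by (intro card_Un_Int[symmetric]) auto
    also have "X \<inter> (\<otimes>) e ` Y = (\<otimes>) e ` Y'" by (auto simp: Y'_def)
    also have "card \<dots> = card Y'"
      using inj by (intro card_image) (auto simp: Y'_def inj_on_def)
    also have "card ((\<otimes>) e ` Y) = card Y" using inj by (rule card_image)
    finally have "card X' + card Y' = card X + card Y" .
    moreover have "card X' + card Y' + card Z \<le> card K + m"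
    proof (rule less.hyps[OF lt])
      show "X' \<subseteq> K" using XY(1,2) e by (auto simp: X'_def)
      show "Y' \<subseteq> K" using XY(2) by (auto simp: Y'_def)
      show "X' \<noteq> {}" using XY(3) by (auto simp: X'_def)
      show "Y' \<noteq> {}" using \<open>b \<in> Y'\<close> by auto
      fix u v assume u: "u \<in> X'" and v: "v \<in> Y'"
      show "u \<otimes> v \<notin> Z"
      proof (cases "u \<in> X")
        case True
        then show ?thesis using XY(5) v by (auto simp: Y'_def)
      next
        case False
        then obtain w where w: "w \<in> Y" "u = e \<otimes> w" using u by (auto simp: X'_def)
        \<comment> \<open>Commutativity lets \<open>e\<close> pass from \<open>w\<close> to
          \<open>v\<close>: as \<open>v\<close> lies in \<open>Y'\<close>, the product is again one
          of an element of \<open>X\<close> and an element of \<open>Y\<close>.\<close>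
        then have "u \<otimes> v = (e \<otimes> v) \<otimes> w"
          using v car ec by (simp add: Y'_def m_ac subset_iff)
        then show ?thesis using XY(5) v w by (auto simp: Y'_def)
      qed
    qed
    ultimately show ?thesis by simp
  next
    case False
    txt \<open>No transform shrinks \<open>Y\<close>, so \<open>Y\<close> lies in a coset of the stabilizer of \<open>X\<close>.\<close>
    define L where "L = {g \<in> K. \<forall>x\<in>X. g \<otimes> x \<in> X}"
    have L: "subgroup L G"
      unfolding L_def using K car finXY by (intro stabilizer_subgroup)
    obtain x0 y0 where x0: "x0 \<in> X" and y0: "y0 \<in> Y" using XY(3,4) by blast
    have "(\<lambda>y. inv y0 \<otimes> y) ` Y \<subseteq> L"
    proof (rule image_subsetI)
      fix y assume y: "y \<in> Y"
      have "inv y0 \<otimes> y \<otimes> x \<in> X" if "x \<in> X" for x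
      proof -
        have "inv y0 \<otimes> y \<otimes> x = x \<otimes> inv y0 \<otimes> y"
          using y y0 that car by (simp add: m_ac subset_iff)
        then show ?thesis using False that y y0 by auto
      qed
      then show "inv y0 \<otimes> y \<in> L"
        using K.m_closed[OF K.m_inv_closed] y y0 XY(2) by (auto simp: L_def subset_iff)
    qed
    moreover have "inj_on (\<lambda>y. inv y0 \<otimes> y) Y"
      using car y0 by (auto simp: inj_on_def subset_iff)
    moreover have "finite L" using fin by (auto simp: L_def)
    ultimately have "card Y \<le> card L" by (metis card_image card_mono)
    \<comment> \<open>If all of \<open>K\<close> stabilized \<open>X\<close>, then \<open>x0\<close>
      could be moved to \<open>z \<otimes> inv y0\<close>, and multiplying by \<open>y0\<close>
      would give the product \<open>z\<close> in \<open>Z\<close>.\<close>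
    moreover have "L \<noteq> K"
    proof
      assume LK: "L = K"
      obtain z where z: "z \<in> Z" using Zne by auto
      have "z \<otimes> inv y0 \<otimes> inv x0 \<in> L"
        unfolding LK using z Z x0 y0 XY(1,2) by (meson K.m_closed K.m_inv_closed subsetD)
      then have "z \<otimes> inv y0 \<otimes> inv x0 \<otimes> x0 \<in> X"
        using x0 by (auto simp: L_def)
      then have "z \<otimes> inv y0 \<in> X"
        using z x0 y0 car by (simp add: m_assoc subset_iff)
      then have "z \<otimes> inv y0 \<otimes> y0 \<notin> Z" using XY(5) y0 by auto
      then show False using z y0 car by (simp add: m_assoc subset_iff)
    qed
    then have "card L \<le> m" using L by (intro m) (auto simp: L_def)
    moreover have "card X + card Z \<le> card K"
    proof (rule sumset_bound_shift[OF K fin XY(1) Z])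
      show "y0 \<in> K" using y0 XY(2) by auto
      show "y0 \<otimes> x \<notin> Z" if "x \<in> X" for x
        using XY(5)[OF that y0] that y0 car by (simp add: m_comm subset_iff)
    qed
    ultimately show ?thesis by linarith
  qed
qed

text \<open>The reflection of \<open>Y\<close> that sends \<open>y\<close> to
  \<open>z \<otimes> inv y\<close> is disjoint from \<open>X\<close>.\<close>

lemma sumset_bound_reflect:
  assumes K: "subgroup K G" and fin: "finite K" and "X \<subseteq> K" and "Y \<subseteq> K" and "z \<in> K"
    and "\<And>x y. x \<in> X \<Longrightarrow> y \<in> Y \<Longrightarrow> x \<otimes> y \<noteq> z"
  shows "card X + card Y \<le> card K"
proof -
  interpret K: subgroup K G by fact
  have car: "X \<subseteq> carrier G" "Y \<subseteq> carrier G" "z \<in> carrier G" using assms K.subset by auto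
  have "finite Y" "finite X" using assms(2-4) by (auto intro: finite_subset)
  moreover have "(\<lambda>y. z \<otimes> inv y) ` Y \<inter> X = {}"
    using assms(6) car by (force simp: m_assoc subset_iff)
  ultimately have "card ((\<lambda>y. z \<otimes> inv y) ` Y \<union> X) = card ((\<lambda>y. z \<otimes> inv y) ` Y) + card X"
    by (intro card_Un_disjoint) auto
  moreover have "card ((\<lambda>y. z \<otimes> inv y) ` Y) = card Y"
    using car by (intro card_image inj_onI) (metis inv_closed inv_inv Units_eq Units_l_cancel subsetD)
  moreover have "(\<lambda>y. z \<otimes> inv y) ` Y \<union> X \<subseteq> K"
    using assms(3-5) by (auto intro: K.m_closed K.m_inv_closed)
  ultimately show ?thesis
    using card_mono[OF fin, of "(\<lambda>y. z \<otimes> inv y) ` Y \<union> X"] by auto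
qed

end

section \<open>The linear system modulo 7\<close>

text \<open>
  The coefficients in the last assumption are \<open>1000 (cos (2\<pi>r/7) + 2/5)\<close>, rounded down. They leave
  little room: the bounds \<open>0.622, -0.227, -0.904\<close> on the cosines would no longer suffice.
\<close>

lemma seven_weights_le:
  fixes a :: "int \<Rightarrow> real"
  assumes a0: "\<And>i. 0 \<le> a i" and a1: "\<And>i. a i \<le> 1"
    and pair: "\<And>i j. 0 < a ((i + j) mod 7) \<Longrightarrow> a i + a j \<le> 1"
    and pair': "\<And>i j. 0 < a i \<Longrightarrow> a j + a ((i + j) mod 7) \<le> 1"
    and triple: "\<And>i j. 0 < a i \<Longrightarrow> 0 < a j \<Longrightarrow> 0 < a ((i + j) mod 7) \<Longrightarrow> a i + a j + a ((i + j) mod 7) \<le> 8/7"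
    and four: "1400 * a 0 + 1023 * a 1 + 1023 * a 6 + 176 * a 2 + 176 * a 5 - 502 * a 3 - 502 * a 4 \<le> 0"
  shows "a 0 + a 1 + a 2 + a 3 + a 4 + a 5 + a 6 \<le> 2"
proof (rule ccontr)
  assume S: "\<not> ?thesis"
  note nn = a0[of 0] a0[of 1] a0[of 2] a0[of 3] a0[of 4] a0[of 5] a0[of 6]
  \<comment> \<open>Otherwise 3 + 2 = 5 and 4 + 5 = 2 modulo 7 force \<open>a 3\<close> and
    \<open>a 4\<close> to vanish; the remaining coefficients in \<open>four\<close> are all
    positive, which contradicts a positive \<open>a 2 + a 5\<close>.\<close>
  have u: "a 2 + a 5 \<le> 1"
  proof (rule ccontr)
    assume *: "\<not> ?thesis"
    then have "a 3 \<le> 0" "a 4 \<le> 0"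
      using pair'[of 3 2] pair'[of 4 5] by (auto simp: not_less[symmetric])
    with * nn four show False by linarith
  qed
  \<comment> \<open>Otherwise 3 + 4 = 0, 1 + 3 = 4 and 6 + 4 = 3 make \<open>a 0\<close>,
    \<open>a 1\<close> and \<open>a 6\<close> vanish. Then 2 + 2 = 4 and 5 + 5 = 3 bound both
    \<open>a 2 + a 4\<close> and \<open>a 5 + a 3\<close> by 1, so the total is at most 2.\<close>
  have s34: "a 3 + a 4 \<le> 1"
  proof (rule ccontr)
    assume *: "\<not> ?thesis"
    then have "a 0 \<le> 0" "a 1 \<le> 0" "a 6 \<le> 0"
      using pair[of 3 4] pair'[of 1 3] pair'[of 6 4] by (auto simp: not_less[symmetric])
    moreover have "a 2 \<le> 0 \<or> a 2 + a 4 \<le> 1" "a 5 \<le> 0 \<or> a 5 + a 3 \<le> 1"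
      using pair'[of 2 2] pair'[of 5 5] by (auto simp: not_less[symmetric])
    ultimately show False
      using a1[of 3] a1[of 4] S by linarith
  qed
  have T: "a i \<le> 0 \<or> a j \<le> 0 \<or> a ((i + j) mod 7) \<le> 0 \<or> a i + a j + a ((i + j) mod 7) \<le> 8/7" for i j
    using triple[of i j] by linarith
  \<comment> \<open>The solutions of i + j = k used here are 0+2=2, 0+4=4, 1+2=3, 2+2=4, 3+3=6,
    4+4=1, 5+5=3 and 5+6=4. After a case split on which weights vanish, each branch is a linear
    problem.\<close>
  show False
    using T[of 0 2] T[of 0 4] T[of 1 2] T[of 2 2] T[of 3 3] T[of 4 4] T[of 5 5] T[of 5 6] nn S four u s34
    by simp (smt (z3))
qed

section \<open>Cosine sums\<close>

lemma sum_cos_residues: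
  assumes "p > 1"
  shows "(\<Sum>r<p. cos (2 * pi * real r / real p)) = 0"
proof -
  define w where "w = cis (2 * pi / real p)"
  have w: "w ^ r = cis (2 * pi * real r / real p)" for r
    by (simp add: w_def Complex.DeMoivre mult_ac)
  have "w ^ p = 1"
    using assms by (simp add: w cis_2pi)
  moreover have "w \<noteq> 1"
  proof
    assume "w = 1"
    then have "w ^ 1 = w ^ 0" by simp
    then show False
      using inj_onD[OF bij_betw_imp_inj_on[OF bij_betw_roots_unity[of p]], of 1 0] assms
      by (auto simp: w w_def)
  qed
  ultimately have "(\<Sum>r<p. w ^ r) = 0"
    by (simp add: geometric_sum)
  then have "Re (\<Sum>r<p. w ^ r) = 0" by simp
  then show ?thesis by (simp add: w)
qed

lemma cos_mod:
  assumes "p > 0"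
  shows "cos (2 * pi * of_int (m mod int p) / real p) = cos (2 * pi * of_int m / real p)"
proof -
  have "m = m mod int p + int p * (m div int p)" by simp
  then have "real_of_int m = of_int (m mod int p) + real p * of_int (m div int p)"
    by (metis of_int_add of_int_mult of_int_of_nat_eq)
  then have "2 * pi * of_int m / real p = 2 * pi * of_int (m mod int p) / real p + 2 * pi * of_int (m div int p)"
    using assms by (simp add: field_simps)
  then show ?thesis
    by (simp only: cos_add cos_int_2pin sin_int_2pin)
qed

text \<open>All three cosines are polynomials in \<open>x = cos (2 * pi / 7)\<close>, which is a
  root of an explicit cubic. A lower bound on \<open>x\<close> suffices, because the polynomials for
  the other two cosines increase from 623/1000 on.\<close>

lemma cos_seventh_bounds:
  shows "623/1000 \<le> cos (2 * pi / 7)" "- 224/1000 \<le> cos (4 * pi / 7)" "- 902/1000 \<le> cos (6 * pi / 7)"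
proof -
  define x where "x = cos (2 * pi / 7)"
  have y: "cos (4 * pi / 7) = 2 * x\<^sup>2 - 1"
    using cos_double_cos[of "2 * pi / 7"] by (simp add: x_def)
  have z: "cos (6 * pi / 7) = 4 * x ^ 3 - 3 * x"
    using cos_treble_cos[of "2 * pi / 7"] by (simp add: x_def)
  \<comment> \<open>The angles 6 pi / 7 and 8 pi / 7 are symmetric about pi. Equating the
    triple-angle and the quadruple-angle formula gives a quartic with the extraneous root 1.\<close>
  have "cos (6 * pi / 7) = cos (2 * (4 * pi / 7))"
    using cos_2pi_minus[of "6 * pi / 7"] by (simp add: field_simps)
  also have "\<dots> = 2 * (2 * x\<^sup>2 - 1)\<^sup>2 - 1"
    unfolding cos_double_cos y ..
  finally have "(x - 1) * (8 * x ^ 3 + 4 * x\<^sup>2 - 4 * x - 1) = 0"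
    unfolding z by (simp add: field_simps power2_eq_square power3_eq_cube)
  moreover have "x > 0" "x < 1"
    unfolding x_def using cos_monotone_0_pi[of 0 "2*pi/7"]
    by (auto intro!: cos_gt_zero_pi simp: field_simps)
  ultimately have poly: "8 * x ^ 3 + 4 * x\<^sup>2 - 4 * x - 1 = 0" by simp
  have x: "x \<ge> 623/1000"
  proof (rule ccontr)
    assume "\<not> ?thesis"
    then have "x < 623/1000" by simp
    \<comment> \<open>Below 623/1000 the bracket is less than 1.6 and the product less than 1, while
      the cubic makes it equal to 1.\<close>
    then have "x * (8 * x\<^sup>2 + 4 * x - 4) \<le> x * (8 * (623/1000)\<^sup>2 + 4 * (623/1000) - 4)"
      using \<open>x > 0\<close> by (intro mult_left_mono add_mono diff_mono power_mono) auto
    also have "\<dots> < 1" using \<open>x < 623/1000\<close> by (simp add: power2_eq_square)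
    finally show False using poly by (simp add: field_simps power2_eq_square power3_eq_cube)
  qed
  have x2: "x\<^sup>2 \<ge> (623/1000)\<^sup>2" using x by (intro power_mono) auto
  show "623/1000 \<le> cos (2 * pi / 7)" using x by (simp add: x_def)
  show "- 224/1000 \<le> cos (4 * pi / 7)" using x2 unfolding y by (simp add: power2_eq_square)
  have "623/1000 * (4 * (623/1000)\<^sup>2 - 3) \<ge> - (902/1000 :: real)" by (simp add: power2_eq_square)
  moreover have "x * (4 * x\<^sup>2 - 3) \<ge> 623/1000 * (4 * (623/1000)\<^sup>2 - 3)"
  proof -
    \<comment> \<open>This is the factored difference of 4 x^3 - 3 x at \<open>x\<close> and at
      623/1000; its second factor is positive since 12 times the square of 623/1000 exceeds
      3.\<close>
    have "0 \<le> (x - 623/1000) * (4 * (x\<^sup>2 + x * (623/1000) + (623/1000)\<^sup>2) - 3)"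
      using x x2 by (intro mult_nonneg_nonneg) (auto simp: power2_eq_square)
    then show ?thesis by (simp add: field_simps power2_eq_square)
  qed
  ultimately show "- 902/1000 \<le> cos (6 * pi / 7)"
    unfolding z by (simp add: field_simps power2_eq_square power3_eq_cube)
qed

section \<open>Linear functionals on \<open>F\<^sub>p\<^sup>s\<close>\<close>

lemma comm_group_Zp_power: "comm_group (Zp_power p s)"
proof -
  have "group (Zp_power p s)" by (simp add: Zp_power_def)
  then show ?thesis
    by (rule group.group_comm_groupI)
       (auto simp: Zp_power_def add.commute intro!: restrict_ext)
qed

locale Zp_space =
  fixes p s :: nat
  assumes p: "prime p"
begin

abbreviation G where "G \<equiv> Zp_power p s"

sublocale comm_group G by (rule comm_group_Zp_power)

lemma carrier_Zp_power: "carrier G = (\<Pi>\<^sub>E i\<in>{..<s}. {0..<int p})"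
  using p by (simp add: Zp_power_def carrier_integer_mod_group)

lemma mult_Zp_power: "i < s \<Longrightarrow> (x \<otimes>\<^bsub>G\<^esub> y) i = (x i + y i) mod int p"
  by (simp add: Zp_power_def)

lemma finite_Zp_power: "finite (carrier G)"
  by (simp add: carrier_Zp_power finite_PiE)

lemma card_Zp_power: "card (carrier G) = p ^ s"
  by (simp add: carrier_Zp_power card_PiE)

lemma Zp_power_eqI:
  assumes "x \<in> carrier G" "y \<in> carrier G"
    and "\<And>i. i < s \<Longrightarrow> int p dvd x i - y i"
  shows "x = y"
proof (rule PiE_ext)
  show "x \<in> (\<Pi>\<^sub>E i\<in>{..<s}. {0..<int p})" "y \<in> (\<Pi>\<^sub>E i\<in>{..<s}. {0..<int p})"
    using assms by (simp_all only: carrier_Zp_power)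
  then show "x i = y i" if "i \<in> {..<s}" for i
    using that assms(3)[of i] by (force simp: mod_eq_dvd_iff[symmetric] PiE_iff Ball_def)
qed

text \<open>Kept as an unreduced integer, so that it is exactly linear in coordinatewise
  differences, which may leave \<open>carrier G\<close>. Reduction modulo \<open>p\<close> is left
  to each use.\<close>

definition dot :: "(nat \<Rightarrow> int) \<Rightarrow> (nat \<Rightarrow> int) \<Rightarrow> int" where
  "dot v x = (\<Sum>i<s. v i * x i)"

lemma dot_commute: "dot v x = dot x v"
  by (simp add: dot_def mult.commute)

lemma dot_mult: "dot v (x \<otimes>\<^bsub>G\<^esub> y) mod int p = (dot v x + dot v y) mod int p"
proof -
  have "dot v (x \<otimes>\<^bsub>G\<^esub> y) = (\<Sum>i<s. v i * ((x i + y i) mod int p))"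
    by (simp add: dot_def mult_Zp_power)
  also have "\<dots> mod int p = (\<Sum>i<s. v i * (x i + y i)) mod int p"
    by (subst (1 2) mod_sum_eq[symmetric]) (simp add: mod_mult_right_eq)
  finally show ?thesis by (simp add: dot_def algebra_simps sum.distrib)
qed

lemma dot_one: "dot \<one>\<^bsub>G\<^esub> x = 0"
  by (simp add: dot_def Zp_power_def)

text \<open>Some coordinate of \<open>v\<close> is invertible modulo \<open>p\<close>;
  \<open>t r\<close> puts \<open>r\<close> times its inverse there and 0 elsewhere. This is a
  homomorphic section of \<open>dot v\<close>, and translating by it carries one fibre of
  \<open>dot v\<close> to another.\<close>

lemma dot_section:
  assumes "\<exists>i<s. \<not> int p dvd v i"
  obtains t where "\<And>r. t r \<in> carrier G" "\<And>r. dot v (t r) mod int p = r mod int p"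
    "\<And>r q. t r \<otimes>\<^bsub>G\<^esub> t q = t (r + q)" "\<And>r. t (r mod int p) = t r"
proof -
  obtain i where i: "i < s" "\<not> int p dvd v i" using assms by blast
  then have "coprime (v i) (int p)"
    using p prime_imp_coprime[of "int p" "v i"] by (simp add: coprime_commute)
  then obtain u where u: "[v i * u = 1] (mod int p)"
    using cong_solve_coprime_int by blast
  define t where "t = (\<lambda>r::int. \<lambda>j\<in>{..<s}. if j = i then (r * u) mod int p else 0)"
  have p0: "int p > 0" using p prime_gt_0_nat by simp
  show thesis
  proof
    show "t r \<in> carrier G" for r
      using p0 by (auto simp: t_def carrier_Zp_power)
    show "t r \<otimes>\<^bsub>G\<^esub> t q = t (r + q)" for r q
      by (rule ext) (auto simp: t_def Zp_power_def mod_add_eq ring_distribs)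
    show "t (r mod int p) = t r" for r
      by (rule ext) (auto simp: t_def mod_mult_left_eq)
    show "dot v (t r) mod int p = r mod int p" for r
    proof -
      have "dot v (t r) = (\<Sum>j<s. if j = i then v j * ((r * u) mod int p) else 0)"
        unfolding dot_def t_def by (intro sum.cong) auto
      also have "\<dots> = v i * ((r * u) mod int p)"
        using i by simp
      also have "[\<dots> = r * (v i * u)] (mod int p)"
        by (simp add: cong_def mod_mult_right_eq mult_ac)
      also have "[r * (v i * u) = r * 1] (mod int p)"
        using u by (rule cong_scalar_left)
      finally show ?thesis by (simp add: cong_def)
    qed
  qed
qed

text \<open>Translation by \<open>t (r - q)\<close> injects the fibre over \<open>q\<close> into the
  fibre over \<open>r\<close>, so all \<open>p\<close> fibres have equal size.\<close>

lemma card_dot_fibre: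
  assumes v: "\<exists>i<s. \<not> int p dvd v i" and r: "r \<in> {0..<int p}"
  shows "p * card {x \<in> carrier G. dot v x mod int p = r} = p ^ s"
proof -
  define F where "F = (\<lambda>r. {x \<in> carrier G. dot v x mod int p = r})"
  obtain t where t: "\<And>r. t r \<in> carrier G" "\<And>r. dot v (t r) mod int p = r mod int p"
    using dot_section[OF v] by metis
  have p0: "int p > 0" using p prime_gt_0_nat by simp
  have le: "card (F q) \<le> card (F r)" if "q \<in> {0..<int p}" "r \<in> {0..<int p}" for q r
  proof (rule card_inj_on_le)
    show "inj_on (\<lambda>x. x \<otimes>\<^bsub>G\<^esub> t (r - q)) (F q)"
      using t by (auto simp: inj_on_def F_def)
    show "(\<lambda>x. x \<otimes>\<^bsub>G\<^esub> t (r - q)) ` F q \<subseteq> F r"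
    proof (rule image_subsetI)
      fix x assume x: "x \<in> F q"
      have "dot v (x \<otimes>\<^bsub>G\<^esub> t (r - q)) mod int p
          = (dot v x mod int p + dot v (t (r - q)) mod int p) mod int p"
        by (simp add: dot_mult mod_add_eq)
      also have "\<dots> = r"
        using x that t by (simp add: F_def mod_add_right_eq)
      finally show "x \<otimes>\<^bsub>G\<^esub> t (r - q) \<in> F r"
        using x t by (simp add: F_def)
    qed
    show "finite (F r)" using finite_Zp_power by (simp add: F_def)
  qed
  have "carrier G = (\<Union>q\<in>{0..<int p}. F q)"
    using p0 by (auto simp: F_def)
  then have "p ^ s = card (\<Union>q\<in>{0..<int p}. F q)"
    by (metis card_Zp_power)
  also have "\<dots> = (\<Sum>q\<in>{0..<int p}. card (F q))"
    by (rule card_UN_disjoint) (auto simp: F_def finite_Zp_power)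
  also have "\<dots> = (\<Sum>q\<in>{0..<int p}. card (F r))"
    using le r by (intro sum.cong) (auto intro!: antisym)
  finally show ?thesis by (simp add: F_def)
qed

section \<open>The lower bound by averaging over functionals\<close>

lemma nonzero_coordinate:
  assumes "x \<in> nonzero_elems G"
  shows "\<exists>i<s. \<not> int p dvd x i"
proof (rule ccontr)
  assume "\<not> ?thesis"
  then have "x = \<one>\<^bsub>G\<^esub>"
    using assms by (intro Zp_power_eqI) (auto simp: nonzero_elems_def Zp_power_def)
  then show False using assms by (simp add: nonzero_elems_def)
qed

text \<open>\<open>S\<close> consists of the residues from p/3 to below 2p/3. Two of them add up to
  a number from 2p/3 to below 4p/3, whose residue misses \<open>S\<close>. For p = 7 this is {3, 4},
  and the bound 2/7 is attained.\<close>

lemma middle_third: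
  obtains S where "S \<subseteq> {0..<int p}" "0 \<notin> S" "2 * p \<le> 7 * card S"
    "\<And>x y. x \<in> S \<Longrightarrow> y \<in> S \<Longrightarrow> (x + y) mod int p \<notin> S"
proof
  let ?S = "{(int p + 2) div 3 ..< (2 * int p + 2) div 3}"
  have p1: "p > 1" using p by (rule prime_gt_1_nat)
  have S: "x \<in> ?S \<longleftrightarrow> int p \<le> 3 * x \<and> 3 * x < 2 * int p" for x
    by auto
  show "?S \<subseteq> {0..<int p}" using S by force
  show "0 \<notin> ?S" using p1 by auto
  \<comment> \<open>In the class p = 3k + 1 the set has \<open>k\<close> elements and the bound
    needs k >= 2; the value k = 1 would be p = 4.\<close>
  have "p \<noteq> 4"
    using p prime_nat_iff[of 4] by (auto simp: dvd_def intro: exI[of _ 2])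
  have "2 * int p \<le> 7 * ((2 * int p + 2) div 3 - (int p + 2) div 3)"
  proof -
    define k where "k = int p div 3"
    consider "int p = 3 * k" | "int p = 3 * k + 1" | "int p = 3 * k + 2"
      unfolding k_def by linarith
    then show ?thesis
    proof cases
      case 1
      then have "(int p + 2) div 3 = k" "(2 * int p + 2) div 3 = 2 * k" by auto
      then show ?thesis using 1 p1 by simp
    next
      case 2
      then have "(int p + 2) div 3 = k + 1" "(2 * int p + 2) div 3 = 2 * k + 1" by auto
      moreover have "k \<ge> 2" using 2 \<open>p \<noteq> 4\<close> p1 by presburger
      ultimately show ?thesis using 2 by simp
    next
      case 3
      then have "(int p + 2) div 3 = k + 1" "(2 * int p + 2) div 3 = 2 * k + 2" by auto
      then show ?thesis using 3 p1 by simp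
    qed
  qed
  then show "2 * p \<le> 7 * card ?S"
    by simp
  show "(x + y) mod int p \<notin> ?S" if "x \<in> ?S" "y \<in> ?S" for x y
  proof -
    have xy: "int p \<le> 3 * x" "3 * x < 2 * int p" "int p \<le> 3 * y" "3 * y < 2 * int p"
      using that unfolding S by blast+
    have "(x + y) mod int p = (if x + y < int p then x + y else x + y - int p)"
    proof (cases "x + y < int p")
      case True
      then show ?thesis using xy by (simp add: mod_pos_pos_trivial)
    next
      case False
      then have "(x + y) mod int p = (x + y - int p) mod int p"
        using p1 by (intro mod_pos_geq) auto
      also have "\<dots> = x + y - int p"
        using False xy by (intro mod_pos_pos_trivial) linarith+
      finally show ?thesis using False by simp
    qed
    then show ?thesis using xy unfolding S by (auto split: if_splits)
  qed
qed

text \<open>An indexed family covers both cases of the theorem: the identity on a set, and the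
  positions of a list. The proof counts the pairs of a functional \<open>v\<close> and an index
  \<open>i\<close> for which \<open>dot v (f i)\<close> falls into \<open>S\<close>.\<close>

lemma exists_large_sum_free:
  fixes f :: "'i \<Rightarrow> nat \<Rightarrow> int"
  assumes I: "finite I" "I \<noteq> {}" and f: "f ` I \<subseteq> nonzero_elems G"
  obtains J where "J \<subseteq> I" "2 * card I < 7 * card J"
    "\<And>j l r. j \<in> J \<Longrightarrow> l \<in> J \<Longrightarrow> r \<in> J \<Longrightarrow> f j \<otimes>\<^bsub>G\<^esub> f l \<noteq> f r"
proof -
  obtain S where S: "S \<subseteq> {0..<int p}" "0 \<notin> S" "2 * p \<le> 7 * card S"
    "\<And>x y. x \<in> S \<Longrightarrow> y \<in> S \<Longrightarrow> (x + y) mod int p \<notin> S"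
    using middle_third by blast
  have finS: "finite S" using S(1) finite_subset by blast
  define J where "J = (\<lambda>v. {i \<in> I. dot v (f i) mod int p \<in> S})"
  have "\<exists>v\<in>carrier G. 2 * card I < 7 * card (J v)"
  proof (rule ccontr)
    assume "\<not> ?thesis"
    then have le: "7 * card (J v) \<le> 2 * card I" if "v \<in> carrier G" for v
      using that by force
    \<comment> \<open>For fixed \<open>i\<close> the roles are exchanged: \<open>f i\<close> acts as
      the non-zero functional and \<open>v\<close> runs through the group.\<close>
    have fibre: "p * card {v \<in> carrier G. dot v (f i) mod int p \<in> S} = card S * p ^ s" if "i \<in> I" for i
    proof -
      have "{v \<in> carrier G. dot v (f i) mod int p \<in> S}
          = (\<Union>r\<in>S. {v \<in> carrier G. dot (f i) v mod int p = r})"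
        by (auto simp: dot_commute[of "f i"])
      also have "card \<dots> = (\<Sum>r\<in>S. card {v \<in> carrier G. dot (f i) v mod int p = r})"
        using finS finite_Zp_power by (intro card_UN_disjoint) auto
      also have "p * \<dots> = (\<Sum>r\<in>S. p ^ s)"
        unfolding sum_distrib_left
        using S(1) f that by (intro sum.cong card_dot_fibre nonzero_coordinate) auto
      finally show ?thesis by simp
    qed
    define T where "T = (\<Sum>v\<in>carrier G. card (J v))"
    have "T = (\<Sum>i\<in>I. card {v \<in> carrier G. dot v (f i) mod int p \<in> S})"
      unfolding T_def J_def by (intro sum_multicount_gen finite_Zp_power I) auto
    then have "p * T = card I * (card S * p ^ s)"
      by (simp add: sum_distrib_left fibre)
    \<comment> \<open>The zero functional captures no index, so at most \<open>p ^ s - 1\<close>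
      functionals contribute to \<open>T\<close>; this makes the final inequality strict.\<close>
    moreover have "J \<one>\<^bsub>G\<^esub> = {}"
      using S(2) by (simp add: J_def dot_one)
    then have "T = (\<Sum>v\<in>carrier G - {\<one>\<^bsub>G\<^esub>}. card (J v))"
      unfolding T_def by (intro sum.mono_neutral_right finite_Zp_power) auto
    moreover have "7 * (\<Sum>v\<in>carrier G - {\<one>\<^bsub>G\<^esub>}. card (J v)) \<le> (\<Sum>v\<in>carrier G - {\<one>\<^bsub>G\<^esub>}. 2 * card I)"
      unfolding sum_distrib_left using le by (intro sum_mono) auto
    moreover have "(\<Sum>v\<in>carrier G - {\<one>\<^bsub>G\<^esub>}. 2 * card I) = (p ^ s - 1) * (2 * card I)"
      using finite_Zp_power by (simp add: card_Zp_power)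
    ultimately have total: "p * T = card I * (card S * p ^ s)" and "7 * T \<le> (p ^ s - 1) * (2 * card I)"
      by (simp_all add: card_Zp_power)
    then have "p * (7 * T) \<le> p * ((p ^ s - 1) * (2 * card I))"
      by (intro mult_le_mono2)
    also have "p * (7 * T) = 7 * (card I * (card S * p ^ s))"
      using total by simp
    finally have "7 * (card I * (card S * p ^ s)) \<le> p * ((p ^ s - 1) * (2 * card I))" .
    also have "\<dots> = 2 * p * (p ^ s - 1) * card I" by (simp add: mult_ac)
    also have "\<dots> < 2 * p * p ^ s * card I"
      using I p prime_gt_0_nat[OF p] by (simp add: card_gt_0_iff)
    also have "\<dots> \<le> 7 * card S * p ^ s * card I"
      by (intro mult_right_mono S(3)) auto
    finally show False by (simp add: mult_ac)
  qed
  then obtain v where v: "v \<in> carrier G" "2 * card I < 7 * card (J v)" by blast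
  show thesis
  proof
    show "J v \<subseteq> I" by (auto simp: J_def)
    show "2 * card I < 7 * card (J v)" by (rule v)
    show "f j \<otimes>\<^bsub>G\<^esub> f l \<noteq> f r" if "j \<in> J v" "l \<in> J v" "r \<in> J v" for j l r
    proof
      assume "f j \<otimes>\<^bsub>G\<^esub> f l = f r"
      then have "dot v (f r) mod int p = (dot v (f j) mod int p + dot v (f l) mod int p) mod int p"
        by (metis dot_mult mod_add_eq)
      then show False using S(4) that by (auto simp: J_def)
    qed
  qed
qed

section \<open>Fourier analysis of a sum-free set\<close>

lemma sum_cos_dot:
  assumes "\<exists>i<s. \<not> int p dvd v i"
  shows "(\<Sum>x\<in>carrier G. cos (2 * pi * of_int (dot v x) / p)) = 0"
proof -
  have p1: "p > 1" using p by (rule prime_gt_1_nat)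
  define F where "F = (\<lambda>r. {x \<in> carrier G. dot v x mod int p = r})"
  have cosF: "cos (2 * pi * of_int (dot v x) / p) = cos (2 * pi * of_int r / p)" if "x \<in> F r" for x r
    using that cos_mod[of p "dot v x"] p1 by (simp add: F_def)
  have "(\<Sum>x\<in>carrier G. cos (2 * pi * of_int (dot v x) / p))
      = (\<Sum>r\<in>{0..<int p}. \<Sum>x\<in>F r. cos (2 * pi * of_int (dot v x) / p))"
    unfolding F_def using p1 by (intro sum.group[symmetric] finite_Zp_power) auto
  also have "\<dots> = (\<Sum>r\<in>{0..<int p}. real (p ^ s) / p * cos (2 * pi * of_int r / p))"
  proof (rule sum.cong[OF refl])
    fix r assume "r \<in> {0..<int p}"
    then have "p * card (F r) = p ^ s"
      unfolding F_def by (intro card_dot_fibre assms)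
    then have "real (card (F r)) = real (p ^ s) / p"
      using p1 by (simp add: field_simps flip: of_nat_mult)
    moreover have "(\<Sum>x\<in>F r. cos (2 * pi * of_int (dot v x) / p)) = (\<Sum>x\<in>F r. cos (2 * pi * of_int r / p))"
      by (intro sum.cong refl cosF)
    ultimately show "(\<Sum>x\<in>F r. cos (2 * pi * of_int (dot v x) / p)) = real (p ^ s) / p * cos (2 * pi * of_int r / p)"
      by simp
  qed
  also have "\<dots> = real (p ^ s) / p * (\<Sum>r\<in>{0..<int p}. cos (2 * pi * of_int r / p))"
    by (simp add: sum_distrib_left)
  also have "(\<Sum>r\<in>{0..<int p}. cos (2 * pi * of_int r / p)) = (\<Sum>r<p. cos (2 * pi * real r / p))"
    by (rule sum.reindex_bij_witness[of _ int nat]) auto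
  also have "\<dots> = 0" using p1 by (rule sum_cos_residues)
  finally show ?thesis by simp
qed

text \<open>Let \<open>C v\<close> be the squared modulus and \<open>R v\<close> the real part of
  the Fourier coefficient of \<open>A\<close>, with n = |A| and N = p^s. By orthogonality the sum of
  \<open>C\<close> is nN, and the sum of \<open>C * R\<close> is 0 because \<open>A\<close> is
  sum-free. The trivial character contributes n^2 and n^3 to these sums. If every other
  \<open>R v\<close> exceeded -cn, then -n^3 >= -cn (nN - n^2), contrary to c (N - n) < n.\<close>

lemma exists_negative_character_sum:
  assumes A: "A \<subseteq> carrier G" and sf: "sum_free G A" and ne: "A \<noteq> {}"
    and c: "c * (real p ^ s - card A) < card A"
  shows "\<exists>v\<in>nonzero_elems G. (\<Sum>x\<in>A. cos (2 * pi * of_int (dot v x) / p)) \<le> - c * card A"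
proof (rule ccontr)
  assume neg: "\<not> ?thesis"
  have finA: "finite A" using A finite_Zp_power finite_subset by blast
  define h where "h = (\<lambda>v x. 2 * pi * of_int (dot v x) / p)"
  define R where "R = (\<lambda>v. \<Sum>x\<in>A. cos (h v x))"
  define C where "C = (\<lambda>v. \<Sum>a\<in>A. \<Sum>b\<in>A. cos (h v a - h v b))"
  define N where "N = real p ^ s"
  define n where "n = real (card A)"
  have C_nonneg: "C v \<ge> 0" for v
  proof -
    have "C v = (\<Sum>a\<in>A. cos (h v a))\<^sup>2 + (\<Sum>a\<in>A. sin (h v a))\<^sup>2"
      by (simp add: C_def cos_diff sum.distrib power2_eq_square sum_product)
    then show ?thesis by simp
  qed
  have char0: "(\<Sum>v\<in>carrier G. cos (2 * pi * of_int (dot v w) / p)) = 0"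
    if "\<exists>i<s. \<not> int p dvd w i" for w
    using sum_cos_dot[OF that] by (simp add: dot_commute)
  have diff: "\<exists>i<s. \<not> int p dvd a i - b i" if "a \<in> A" "b \<in> A" "a \<noteq> b" for a b
    using Zp_power_eqI[of a b] that A by blast
  \<comment> \<open>Sum-freeness enters here: \<open>a - b - c\<close> is never the zero vector, so
    its character sum over all \<open>v\<close> vanishes.\<close>
  have ne_sum: "\<exists>i<s. \<not> int p dvd a i - b i - c i" if "a \<in> A" "b \<in> A" "c \<in> A" for a b c
  proof (rule ccontr)
    assume *: "\<not> ?thesis"
    have "a = b \<otimes>\<^bsub>G\<^esub> c"
    proof (rule Zp_power_eqI)
      show "a \<in> carrier G" "b \<otimes>\<^bsub>G\<^esub> c \<in> carrier G" using that A by auto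
      fix i assume i: "i < s"
      have "[a i = b i + c i] (mod int p)"
        using * i by (simp add: cong_iff_dvd_diff algebra_simps)
      then have "[a i = (b i + c i) mod int p] (mod int p)" by simp
      then show "int p dvd a i - (b \<otimes>\<^bsub>G\<^esub> c) i"
        using i by (simp add: mult_Zp_power cong_iff_dvd_diff)
    qed
    then show False using sf that by (auto simp: sum_free_def)
  qed
  have "(\<Sum>v\<in>carrier G. C v) = (\<Sum>a\<in>A. \<Sum>b\<in>A. \<Sum>v\<in>carrier G. cos (h v a - h v b))"
    unfolding C_def by (subst sum.swap) (simp add: sum.swap[of _ A "carrier G"])
  also have "\<dots> = (\<Sum>a\<in>A. \<Sum>b\<in>A. if a = b then N else 0)"
  proof (intro sum.cong refl)
    fix a b assume ab: "a \<in> A" "b \<in> A"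
    have "h v a - h v b = 2 * pi * of_int (dot v (\<lambda>i. a i - b i)) / p" for v
      by (simp add: h_def dot_def algebra_simps sum_subtractf diff_divide_distrib)
    then show "(\<Sum>v\<in>carrier G. cos (h v a - h v b)) = (if a = b then N else 0)"
      using char0[of "\<lambda>i. a i - b i"] diff[OF ab] by (auto simp: N_def card_Zp_power dot_def)
  qed
  also have "\<dots> = n * N"
    using finA by (simp add: n_def)
  finally have sumC: "(\<Sum>v\<in>carrier G. C v) = n * N" .
  have "(\<Sum>v\<in>carrier G. C v * R v) = (\<Sum>v\<in>carrier G. \<Sum>a\<in>A. \<Sum>b\<in>A. \<Sum>c\<in>A. cos (h v a - h v b) * cos (h v c))"
    unfolding C_def R_def sum_distrib_right by (simp only: sum_distrib_left)
  also have "\<dots> = (\<Sum>a\<in>A. \<Sum>b\<in>A. \<Sum>c\<in>A. \<Sum>v\<in>carrier G. cos (h v a - h v b) * cos (h v c))"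
    by (simp add: sum.swap[of _ A "carrier G"])
  also have "\<dots> = (\<Sum>a\<in>A. \<Sum>b\<in>A. \<Sum>c\<in>A. 0)"
  proof (intro sum.cong refl)
    fix a b c assume abc: "a \<in> A" "b \<in> A" "c \<in> A"
    \<comment> \<open>The product-to-sum formula leaves the characters at \<open>a - b - c\<close>
      and, by evenness of the cosine, at \<open>b - a - c\<close>; \<open>ne_sum\<close> applies to
      both.\<close>
    let ?u = "\<lambda>i. a i - b i - c i" and ?w = "\<lambda>i. b i - a i - c i"
    have "h v a - h v b - h v c = 2 * pi * of_int (dot v ?u) / p" for v
      by (simp add: h_def dot_def algebra_simps sum_subtractf sum.distrib diff_divide_distrib add_divide_distrib)
    moreover have "h v a - h v b + h v c = - (2 * pi * of_int (dot v ?w) / p)" for v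
      by (simp add: h_def dot_def algebra_simps sum_subtractf sum.distrib diff_divide_distrib add_divide_distrib)
    ultimately have "cos (h v a - h v b) * cos (h v c)
        = cos (2 * pi * of_int (dot v ?u) / p) / 2 + cos (2 * pi * of_int (dot v ?w) / p) / 2" for v
      by (simp add: cos_times_cos add_divide_distrib)
    then show "(\<Sum>v\<in>carrier G. cos (h v a - h v b) * cos (h v c)) = 0"
      using char0[OF ne_sum] abc by (simp add: sum.distrib flip: sum_divide_distrib)
  qed
  finally have sumCR: "(\<Sum>v\<in>carrier G. C v * R v) = 0" by simp
  have h1: "h \<one>\<^bsub>G\<^esub> x = 0" for x
    by (simp add: h_def dot_one)
  have C1: "C \<one>\<^bsub>G\<^esub> = n\<^sup>2" and R1: "R \<one>\<^bsub>G\<^esub> = n"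
    by (simp_all add: C_def R_def h1 n_def power2_eq_square)
  have rest: "(\<Sum>v\<in>carrier G - {\<one>\<^bsub>G\<^esub>}. C v) = n * N - n\<^sup>2"
    using sumC C1 by (simp add: sum.remove[OF finite_Zp_power one_closed])
  have "- (c * n) * (n * N - n\<^sup>2) = (\<Sum>v\<in>carrier G - {\<one>\<^bsub>G\<^esub>}. C v * - (c * n))"
    unfolding rest[symmetric] by (simp add: sum_distrib_left sum_negf mult_ac)
  also have "\<dots> \<le> (\<Sum>v\<in>carrier G - {\<one>\<^bsub>G\<^esub>}. C v * R v)"
    using neg by (intro sum_mono mult_left_mono C_nonneg) (auto simp: R_def h_def n_def nonzero_elems_def not_le less_imp_le)
  also have "\<dots> = - (n ^ 3)"
    using sumCR C1 R1 by (simp add: sum.remove[OF finite_Zp_power one_closed] power3_eq_cube power2_eq_square)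
  finally have "n\<^sup>2 * (n - c * (N - n)) \<le> 0"
    by (simp add: algebra_simps power2_eq_square power3_eq_cube)
  moreover have "n\<^sup>2 > 0"
    using ne finA by (simp add: n_def)
  moreover have "n - c * (N - n) > 0"
    using c by (simp add: n_def N_def)
  ultimately show False
    by (simp add: mult_le_0_iff)
qed

section \<open>Densities of a sum-free set in parallel hyperplanes\<close>

lemma subgroup_card_bound:
  assumes "subgroup L G" "L \<subset> K" "card K = p ^ k" "finite K"
  shows "card L \<le> card K div p"
proof -
  \<comment> \<open>By Lagrange \<open>card L\<close> is a power of \<open>p\<close>, hence at most
    \<open>card K\<close> divided by \<open>p\<close> once it is smaller than
    \<open>card K\<close>.\<close>
  have "card L dvd p ^ s"
    using lagrange[OF assms(1)] by (metis card_Zp_power dvd_triv_right order_def)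
  then obtain j where j: "card L = p ^ j"
    using divides_primepow_nat[OF p] by blast
  have "p ^ j < p ^ k"
    using psubset_card_mono[OF assms(4,2)] j assms(3) by simp
  then have "j < k"
    using prime_gt_1_nat[OF p] by simp
  then have "p ^ Suc j dvd p ^ k" by (intro le_imp_power_dvd) simp
  then have "p * card L dvd card K" using assms(3) j by simp
  then have "p * card L \<le> card K"
    using assms(3) prime_gt_0_nat[OF p] by (intro dvd_imp_le) auto
  then show ?thesis
    using prime_gt_0_nat[OF p] by (simp add: less_eq_div_iff_mult_less_eq mult.commute)
qed

text \<open>Each fibre of \<open>dot v\<close> on \<open>A\<close> is translated by \<open>t\<close>
  into the hyperplane \<open>K\<close> through 0, giving \<open>X r\<close>, and \<open>a r\<close>
  is the density of \<open>X r\<close> in \<open>K\<close>. As \<open>t\<close> is a homomorphism,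
  products of \<open>X i\<close> and \<open>X j\<close> avoid \<open>X (i + j)\<close>, so the three
  sumset bounds in \<open>K\<close> apply; the term 1/p is the largest possible density of a proper
  subgroup of \<open>K\<close>. The last clause converts sums over \<open>A\<close> into weighted
  sums of densities, for g = 1 and g a cosine.\<close>

lemma fibre_densities:
  assumes A: "A \<subseteq> carrier G" and sf: "sum_free G A" and v: "\<exists>i<s. \<not> int p dvd v i"
  obtains a :: "int \<Rightarrow> real" where "\<And>r. 0 \<le> a r" "\<And>r. a r \<le> 1"
    "\<And>i j. 0 < a ((i + j) mod int p) \<Longrightarrow> a i + a j \<le> 1"
    "\<And>i j. 0 < a i \<Longrightarrow> a j + a ((i + j) mod int p) \<le> 1"
    "\<And>i j. 0 < a i \<Longrightarrow> 0 < a j \<Longrightarrow> 0 < a ((i + j) mod int p) \<Longrightarrow>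
       a i + a j + a ((i + j) mod int p) \<le> 1 + 1 / p"
    "\<And>g :: int \<Rightarrow> real. real p * (\<Sum>x\<in>A. g (dot v x mod int p)) = real p ^ s * (\<Sum>r\<in>{0..<int p}. a r * g r)"
proof -
  obtain t where t: "\<And>r. t r \<in> carrier G" "\<And>r. dot v (t r) mod int p = r mod int p"
    "\<And>r q. t r \<otimes>\<^bsub>G\<^esub> t q = t (r + q)" "\<And>r. t (r mod int p) = t r"
    using dot_section[OF v] by metis
  have p0: "p > 0" using p by (rule prime_gt_0_nat)
  define K where "K = {x \<in> carrier G. dot v x mod int p = 0}"
  have Kc: "K \<subseteq> carrier G" by (auto simp: K_def)
  have finK: "finite K" using finite_Zp_power by (simp add: K_def)
  have cardK: "p * card K = p ^ s"
    unfolding K_def using p0 by (intro card_dot_fibre v) auto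
  obtain i where "i < s" using v by blast
  then have "p ^ s = p * p ^ (s - 1)" by (cases s) auto
  then have Kpow: "card K = p ^ (s - 1)" using cardK p0 by simp
  have K: "subgroup K G"
  proof (rule subgroupI[OF Kc])
    show "K \<noteq> {}" using Kpow p0 by auto
    fix x assume x: "x \<in> K"
    have "(dot v x + dot v (inv\<^bsub>G\<^esub> x)) mod int p = 0"
      using dot_mult[of v x "inv\<^bsub>G\<^esub> x"] x by (simp add: K_def dot_commute[of v "\<one>\<^bsub>G\<^esub>"] dot_one)
    moreover have "(dot v x + dot v (inv\<^bsub>G\<^esub> x)) mod int p = dot v (inv\<^bsub>G\<^esub> x) mod int p"
      using mod_add_left_eq[of "dot v x" "int p" "dot v (inv\<^bsub>G\<^esub> x)"] x by (simp add: K_def)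
    ultimately show "inv\<^bsub>G\<^esub> x \<in> K" using x by (simp add: K_def)
    fix y assume y: "y \<in> K"
    have "dot v (x \<otimes>\<^bsub>G\<^esub> y) mod int p = (dot v x mod int p + dot v y mod int p) mod int p"
      by (simp add: dot_mult mod_add_eq)
    then show "x \<otimes>\<^bsub>G\<^esub> y \<in> K" using x y by (simp add: K_def)
  qed
  define X where "X = (\<lambda>r. {x \<in> K. x \<otimes>\<^bsub>G\<^esub> t r \<in> A})"
  have XK: "X r \<subseteq> K" for r by (auto simp: X_def)
  have finX: "finite (X r)" for r using XK finK finite_subset by blast
  have Xmod: "X (r mod int p) = X r" for r by (simp add: X_def t)
  have Xsf: "x \<otimes>\<^bsub>G\<^esub> y \<notin> X (i + j)" if "x \<in> X i" "y \<in> X j" for x y i j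
  proof
    assume "x \<otimes>\<^bsub>G\<^esub> y \<in> X (i + j)"
    then have "(x \<otimes>\<^bsub>G\<^esub> y) \<otimes>\<^bsub>G\<^esub> (t i \<otimes>\<^bsub>G\<^esub> t j) \<in> A" by (simp add: X_def t)
    also have "(x \<otimes>\<^bsub>G\<^esub> y) \<otimes>\<^bsub>G\<^esub> (t i \<otimes>\<^bsub>G\<^esub> t j) = (x \<otimes>\<^bsub>G\<^esub> t i) \<otimes>\<^bsub>G\<^esub> (y \<otimes>\<^bsub>G\<^esub> t j)"
    proof -
      have "x \<in> carrier G" "y \<in> carrier G" using that XK Kc by blast+
      then show ?thesis using t(1) by (simp only: m_ac m_closed)
    qed
    finally show False using that sf unfolding sum_free_def X_def by blast
  qed
  define a where "a = (\<lambda>r. real (card (X r)) / card K)"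
  have K0: "real (card K) > 0" using Kpow p0 by simp
  have amod: "a (r mod int p) = a r" for r by (simp add: a_def Xmod)
  have apos: "X r \<noteq> {}" if "0 < a r" for r
    using that by (auto simp: a_def)
  show thesis
  proof
    show "0 \<le> a r" for r by (simp add: a_def)
    show "a r \<le> 1" for r
      using K0 card_mono[OF finK XK, of r] by (simp add: a_def)
    show "a i + a j \<le> 1" if pos: "0 < a ((i + j) mod int p)" for i j
    proof -
      obtain z where "z \<in> X (i + j)" using apos pos unfolding amod by blast
      then have "card (X i) + card (X j) \<le> card K"
        using XK Xsf by (intro sumset_bound_reflect[OF K finK, where z = z]) blast+
      then show ?thesis using K0 by (simp add: a_def field_simps flip: of_nat_add)
    qed
    show "a j + a ((i + j) mod int p) \<le> 1" if pos: "0 < a i" for i j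
    proof -
      obtain x where "x \<in> X i" using apos pos by blast
      then have "card (X j) + card (X (i + j)) \<le> card K"
        using XK Xsf by (intro sumset_bound_shift[OF K finK, where x = x]) blast+
      then show ?thesis using K0 by (simp add: amod) (simp add: a_def field_simps flip: of_nat_add)
    qed
    show "a i + a j + a ((i + j) mod int p) \<le> 1 + 1 / p"
      if "0 < a i" "0 < a j" "0 < a ((i + j) mod int p)" for i j
    proof -
      have "card (X i) + card (X j) + card (X (i + j)) \<le> card K + card K div p"
        using subgroup_card_bound[OF _ _ Kpow finK] Xsf that apos
        by (intro sumset_bound[OF K finK _ XK XK XK]) (auto simp: amod)
      then have "p * (card (X i) + card (X j) + card (X (i + j))) \<le> p * (card K + card K div p)"
        by (rule mult_le_mono2)
      also have "\<dots> \<le> p * card K + card K"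
        by (simp add: distrib_left)
      finally have "real (p * (card (X i) + card (X j) + card (X (i + j)))) \<le> real (p * card K + card K)"
        by (rule of_nat_mono)
      then show ?thesis using K0 p0 by (simp add: amod) (simp add: a_def field_simps)
    qed
    have fibre: "card {y \<in> A. dot v y mod int p = r} = card (X r)" if r: "r \<in> {0..<int p}" for r
    proof (rule bij_betw_same_card[symmetric, OF bij_betw_byWitness[where f' = "\<lambda>y. y \<otimes>\<^bsub>G\<^esub> t (- r)"]])
      have "t 0 \<otimes>\<^bsub>G\<^esub> t 0 = t 0" using t(3)[of 0 0] by simp
      then have t0: "t 0 = \<one>\<^bsub>G\<^esub>" using t(1) by (metis l_cancel_one)
      show "\<forall>x\<in>X r. x \<otimes>\<^bsub>G\<^esub> t r \<otimes>\<^bsub>G\<^esub> t (- r) = x"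
        using XK Kc t by (auto simp: m_assoc t0 subset_iff)
      show *: "\<forall>y\<in>{y \<in> A. dot v y mod int p = r}. y \<otimes>\<^bsub>G\<^esub> t (- r) \<otimes>\<^bsub>G\<^esub> t r = y"
        using A t by (auto simp: m_assoc t0 subset_iff)
      show "(\<lambda>x. x \<otimes>\<^bsub>G\<^esub> t r) ` X r \<subseteq> {y \<in> A. dot v y mod int p = r}"
      proof (rule image_subsetI)
        fix x assume x: "x \<in> X r"
        have "dot v (x \<otimes>\<^bsub>G\<^esub> t r) mod int p = (dot v x mod int p + dot v (t r) mod int p) mod int p"
          by (simp add: dot_mult mod_add_eq)
        then show "x \<otimes>\<^bsub>G\<^esub> t r \<in> {y \<in> A. dot v y mod int p = r}"
          using x r t by (simp add: X_def K_def)
      qed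
      show "(\<lambda>y. y \<otimes>\<^bsub>G\<^esub> t (- r)) ` {y \<in> A. dot v y mod int p = r} \<subseteq> X r"
      proof (rule image_subsetI)
        fix y assume y: "y \<in> {y \<in> A. dot v y mod int p = r}"
        have "dot v (y \<otimes>\<^bsub>G\<^esub> t (- r)) mod int p = (dot v y mod int p + dot v (t (- r)) mod int p) mod int p"
          by (simp add: dot_mult mod_add_eq)
        also have "\<dots> = 0"
          using y by (simp add: t mod_add_right_eq)
        finally show "y \<otimes>\<^bsub>G\<^esub> t (- r) \<in> X r"
          using y * A t by (auto simp: X_def K_def)
      qed
    qed
    show "real p * (\<Sum>x\<in>A. g (dot v x mod int p)) = real p ^ s * (\<Sum>r\<in>{0..<int p}. a r * g r)" for g :: "int \<Rightarrow> real"
    proof -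
      have finA: "finite A" using A finite_Zp_power finite_subset by blast
      have "(\<Sum>x\<in>A. g (dot v x mod int p))
          = (\<Sum>r\<in>{0..<int p}. \<Sum>x\<in>{x \<in> A. dot v x mod int p = r}. g (dot v x mod int p))"
        using p0 finA by (intro sum.group[symmetric]) auto
      also have "\<dots> = (\<Sum>r\<in>{0..<int p}. card K * (a r * g r))"
        using K0 by (intro sum.cong refl) (simp add: fibre a_def)
      finally have "p * (\<Sum>x\<in>A. g (dot v x mod int p)) = real (p * card K) * (\<Sum>r\<in>{0..<int p}. a r * g r)"
        by (simp add: sum_distrib_left mult_ac)
      then show ?thesis by (simp add: cardK of_nat_power)
    qed
  qed
qed

end

section \<open>Sum-free sets modulo 7 have density at most 2/7\<close>

lemma sum_free_card_le_F7:
  assumes A: "A \<subseteq> carrier (Zp_power 7 s)" and sf: "sum_free (Zp_power 7 s) A"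
  shows "7 * card A \<le> 2 * 7 ^ s"
proof (rule ccontr)
  assume big: "\<not> ?thesis"
  interpret Zp_space 7 s by standard simp
  have "A \<noteq> {}" using big by auto
  moreover have "real (2 * 7 ^ s) < real (7 * card A)"
    using big unfolding of_nat_less_iff by simp
  \<comment> \<open>A density above 2/7 makes |A| / (7^s - |A|) exceed (2/7) / (5/7) = 2/5.\<close>
  then have "2 / 5 * (real 7 ^ s - card A) < card A" by simp
  ultimately obtain v where v: "v \<in> nonzero_elems (Zp_power 7 s)"
    and cos_le: "(\<Sum>x\<in>A. cos (2 * pi * of_int (dot v x) / real 7)) \<le> - (2 / 5) * card A"
    using exists_negative_character_sum[OF A sf] by blast
  obtain a :: "int \<Rightarrow> real" where a: "\<And>r. 0 \<le> a r" "\<And>r. a r \<le> 1"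
    "\<And>i j. 0 < a ((i + j) mod int 7) \<Longrightarrow> a i + a j \<le> 1"
    "\<And>i j. 0 < a i \<Longrightarrow> a j + a ((i + j) mod int 7) \<le> 1"
    "\<And>i j. 0 < a i \<Longrightarrow> 0 < a j \<Longrightarrow> 0 < a ((i + j) mod int 7) \<Longrightarrow>
       a i + a j + a ((i + j) mod int 7) \<le> 1 + 1 / real 7"
    and sum_a: "\<And>g :: int \<Rightarrow> real. real 7 * (\<Sum>x\<in>A. g (dot v x mod int 7))
       = real 7 ^ s * (\<Sum>r\<in>{0..<int 7}. a r * g r)"
    using fibre_densities[OF A sf nonzero_coordinate[OF v]] by blast
  have sum7: "(\<Sum>r\<in>{0..<int 7}. f r) = f 0 + f 1 + f 2 + f 3 + f 4 + f 5 + f 6" for f :: "int \<Rightarrow> real"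
  proof -
    have "{0..<int 7} = {0, 1, 2, 3, 4, 5, 6}" by auto
    then show ?thesis by (simp only:) simp
  qed
  define c where "c = (\<lambda>r::int. cos (2 * pi * of_int r / real 7))"
  define S where "S = a 0 + a 1 + a 2 + a 3 + a 4 + a 5 + a 6"
  \<comment> \<open>Hence the assumption that \<open>A\<close> is too large amounts to S >
    2.\<close>
  have card_A: "7 * card A = 7 ^ s * S"
    using sum_a[of "\<lambda>_. 1"] unfolding sum7 by (simp add: S_def)
  have cs: "c 0 = 1" "c 4 = c 3" "c 5 = c 2" "c 6 = c 1"
    using cos_2pi_minus[of "6 * pi / 7"] cos_2pi_minus[of "4 * pi / 7"] cos_2pi_minus[of "2 * pi / 7"]
    by (simp_all add: c_def field_simps)
  have "7 * (\<Sum>x\<in>A. cos (2 * pi * of_int (dot v x) / real 7))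
      = 7 ^ s * (a 0 + c 1 * (a 1 + a 6) + c 2 * (a 2 + a 5) + c 3 * (a 3 + a 4))"
  proof -
    have "c (m mod int 7) = cos (2 * pi * of_int m / real 7)" for m
      unfolding c_def by (rule cos_mod) simp
    then show ?thesis
      using sum_a[of c] unfolding sum7 cs by (simp add: algebra_simps)
  qed
  then have "7 ^ s * (a 0 + c 1 * (a 1 + a 6) + c 2 * (a 2 + a 5) + c 3 * (a 3 + a 4)) \<le> 7 ^ s * (- (2 / 5) * S)"
    using cos_le card_A by simp
  then have main: "a 0 + c 1 * (a 1 + a 6) + c 2 * (a 2 + a 5) + c 3 * (a 3 + a 4) \<le> - (2 / 5) * S"
    by (rule mult_left_le_imp_le) simp
  \<comment> \<open>Lower bounds on the cosines suffice, since the densities are nonnegative and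
    \<open>main\<close> bounds their combination from above. Moving \<open>S\<close> to the left
    adds 2/5 to each coefficient.\<close>
  have "c 1 * (a 1 + a 6) \<ge> 623/1000 * (a 1 + a 6)" "c 2 * (a 2 + a 5) \<ge> - 224/1000 * (a 2 + a 5)"
    "c 3 * (a 3 + a 4) \<ge> - 902/1000 * (a 3 + a 4)"
    using cos_seventh_bounds by (intro mult_right_mono add_nonneg_nonneg a; simp add: c_def)+
  then have "1400 * a 0 + 1023 * a 1 + 1023 * a 6 + 176 * a 2 + 176 * a 5 - 502 * a 3 - 502 * a 4 \<le> 0"
    using main unfolding S_def by (simp add: field_simps)
  then have "S \<le> 2"
    unfolding S_def using a by (intro seven_weights_le) simp_all
  then have "7 ^ s * S \<le> 7 ^ s * 2" by simp
  then have "real (7 * card A) \<le> real (2 * 7 ^ s)"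
    using card_A by simp
  then show False using big by linarith
qed

section \<open>Maximal sum-free sets and sequences\<close>

lemma card_le_max_sum_free_set:
  assumes "finite B" "A \<subseteq> B" "sum_free G A"
  shows "card A \<le> max_sum_free_set G B"
  unfolding max_sum_free_set_def
proof (rule Max_ge)
  have "{card A |A. A \<subseteq> B \<and> sum_free G A} \<subseteq> card ` Pow B" by auto
  then show "finite {card A |A. A \<subseteq> B \<and> sum_free G A}"
    using assms(1) finite_subset by fast
qed (use assms in auto)

lemma max_sum_free_set_attained:
  assumes "finite B"
  obtains A where "A \<subseteq> B" "sum_free G A" "card A = max_sum_free_set G B"
proof -
  have "{card A |A. A \<subseteq> B \<and> sum_free G A} \<subseteq> card ` Pow B" by auto
  then have "finite {card A |A. A \<subseteq> B \<and> sum_free G A}"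
    using assms finite_subset by fast
  moreover have "card {} \<in> {card A |A. A \<subseteq> B \<and> sum_free G A}"
    by (rule CollectI, rule exI[of _ "{}"]) (simp add: sum_free_def)
  ultimately have "max_sum_free_set G B \<in> {card A |A. A \<subseteq> B \<and> sum_free G A}"
    unfolding max_sum_free_set_def by (intro Max_in) auto
  then show thesis using that by auto
qed

lemma card_le_max_sum_free_seq:
  assumes "I \<subseteq> {..<length as}" "sum_free_indices G as I"
  shows "card I \<le> max_sum_free_seq G as"
  unfolding max_sum_free_seq_def
proof (rule Max_ge)
  have "{card I |I. I \<subseteq> {..<length as} \<and> sum_free_indices G as I} \<subseteq> card ` Pow {..<length as}" by auto
  then show "finite {card I |I. I \<subseteq> {..<length as} \<and> sum_free_indices G as I}"
    by (rule finite_subset) simp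
qed (use assms in auto)

lemma max_sum_free_seq_attained:
  obtains I where "I \<subseteq> {..<length as}" "sum_free_indices G as I" "card I = max_sum_free_seq G as"
proof -
  have "{card I |I. I \<subseteq> {..<length as} \<and> sum_free_indices G as I} \<subseteq> card ` Pow {..<length as}" by auto
  then have "finite {card I |I. I \<subseteq> {..<length as} \<and> sum_free_indices G as I}"
    by (rule finite_subset) simp
  moreover have "card {} \<in> {card I |I. I \<subseteq> {..<length as} \<and> sum_free_indices G as I}"
    by (rule CollectI, rule exI[of _ "{}"]) (simp add: sum_free_indices_def)
  ultimately have "max_sum_free_seq G as \<in> {card I |I. I \<subseteq> {..<length as} \<and> sum_free_indices G as I}"
    unfolding max_sum_free_seq_def by (intro Max_in) auto
  then show thesis using that by auto
qed

text \<open>With distinct terms, a sum-free set of positions maps injectively onto a sum-free set of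
  values. The sharpness bound for sets thus carries over to sequences.\<close>

lemma max_sum_free_seq_distinct_le:
  assumes "distinct as"
  shows "max_sum_free_seq G as \<le> max_sum_free_set G (set as)"
proof -
  obtain I where I: "I \<subseteq> {..<length as}" "sum_free_indices G as I" "card I = max_sum_free_seq G as"
    by (rule max_sum_free_seq_attained)
  have "card ((!) as ` I) \<le> max_sum_free_set G (set as)"
    using I by (intro card_le_max_sum_free_set) (auto simp: sum_free_def sum_free_indices_def)
  moreover have "card ((!) as ` I) = card I"
    using I(1) assms by (intro card_image inj_on_nth) auto
  ultimately show ?thesis using I(3) by simp
qed

section \<open>The bounds expressed through the maxima\<close>

lemma sum_free_set_lower_bound:
  assumes "prime p" "finite B" "B \<noteq> {}" "B \<subseteq> nonzero_elems (Zp_power p s)"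
  shows "2 / 7 * real (card B) < real (max_sum_free_set (Zp_power p s) B)"
proof -
  interpret Zp_space p s by standard fact
  obtain J where J: "J \<subseteq> B" "2 * card B < 7 * card J"
    "\<And>j l r. j \<in> J \<Longrightarrow> l \<in> J \<Longrightarrow> r \<in> J \<Longrightarrow> j \<otimes>\<^bsub>Zp_power p s\<^esub> l \<noteq> r"
    using exists_large_sum_free[of B "\<lambda>x. x"] assms by auto
  have "card J \<le> max_sum_free_set (Zp_power p s) B"
    using J assms(2) by (intro card_le_max_sum_free_set) (auto simp: sum_free_def)
  then show ?thesis using J(2) by linarith
qed

lemma sum_free_seq_lower_bound:
  assumes "prime p" "as \<noteq> []" "set as \<subseteq> nonzero_elems (Zp_power p s)"
  shows "2 / 7 * real (length as) < real (max_sum_free_seq (Zp_power p s) as)"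
proof -
  interpret Zp_space p s by standard fact
  have "(!) as ` {..<length as} \<subseteq> nonzero_elems (Zp_power p s)"
    using assms(3) by auto
  moreover have "{..<length as} \<noteq> {}"
    using assms(2) by (simp add: lessThan_empty_iff)
  ultimately obtain J where J: "J \<subseteq> {..<length as}" "2 * length as < 7 * card J"
    "\<And>j l r. j \<in> J \<Longrightarrow> l \<in> J \<Longrightarrow> r \<in> J \<Longrightarrow> as ! j \<otimes>\<^bsub>Zp_power p s\<^esub> as ! l \<noteq> as ! r"
    using exists_large_sum_free[of "{..<length as}" "(!) as"] by auto
  have "card J \<le> max_sum_free_seq (Zp_power p s) as"
    using J by (intro card_le_max_sum_free_seq) (auto simp: sum_free_indices_def)
  then show ?thesis using J(2) by linarith
qed

text \<open>All non-zero elements of \<open>F_7^s\<close> serve as the example: a sum-free subset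
  has at most 2/7 of 7^s elements, and the ratio to 7^s - 1 tends to 2/7 as \<open>s\<close>
  grows.\<close>

lemma two_sevenths_best_possible:
  fixes c :: real
  assumes "c > 2 / 7"
  obtains s as where "s \<ge> 1" "distinct as" "set as = nonzero_elems (Zp_power 7 s)"
    "real (max_sum_free_set (Zp_power 7 s) (set as)) < c * real (length as)"
proof -
  \<comment> \<open>The threshold is the inequality c < 7^s (c - 2/7) solved for 7^s; passing to
    \<open>Suc n\<close> ensures s >= 1.\<close>
  obtain n :: nat where n: "c / (c - 2 / 7) < 7 ^ n"
    using real_arch_pow[of 7 "c / (c - 2 / 7)"] by auto
  define s where "s = Suc n"
  interpret Zp_space 7 s by standard simp
  note n
  also have "(7 :: real) ^ n \<le> 7 ^ s"
    by (simp add: s_def)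
  finally have "c / (c - 2 / 7) < 7 ^ s" .
  then have "c < 7 ^ s * (c - 2 / 7)"
    using assms by (simp add: field_simps)
  then have key: "2 * 7 ^ s / 7 < c * (7 ^ s - 1)"
    by (simp add: field_simps)
  have fin: "finite (nonzero_elems (Zp_power 7 s))"
    using finite_Zp_power by (simp add: nonzero_elems_def)
  then obtain as where as: "set as = nonzero_elems (Zp_power 7 s)" "distinct as"
    using finite_distinct_list by blast
  have "length as = 7 ^ s - 1"
    using as distinct_card[of as] finite_Zp_power card_Zp_power by (simp add: nonzero_elems_def)
  then have len: "real (length as) = 7 ^ s - 1" by (simp add: of_nat_diff)
  obtain A where A: "A \<subseteq> set as" "sum_free (Zp_power 7 s) A"
    "card A = max_sum_free_set (Zp_power 7 s) (set as)"
    by (rule max_sum_free_set_attained[of "set as"]) auto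
  have "7 * card A \<le> 2 * 7 ^ s"
    using A as by (intro sum_free_card_le_F7) (auto simp: nonzero_elems_def)
  then have "real (7 * card A) \<le> real (2 * 7 ^ s)" by (rule of_nat_mono)
  then have "real (card A) \<le> 2 * 7 ^ s / 7" by simp
  then show thesis
    using that[of s as] A(3) as key len by (simp add: s_def)
qed

theorem theorem4:
  shows
    "(\<forall>p s :: nat. prime p \<and> s \<ge> 1 \<longrightarrow>
        (\<forall>B. finite B \<and> B \<noteq> {} \<and> B \<subseteq> nonzero_elems (Zp_power p s) \<longrightarrow>
           real (max_sum_free_set (Zp_power p s) B) > 2 / 7 * real (card B)) \<and>
        (\<forall>as. as \<noteq> [] \<and> set as \<subseteq> nonzero_elems (Zp_power p s) \<longrightarrow>
           real (max_sum_free_seq (Zp_power p s) as) > 2 / 7 * real (length as))) \<and>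
     (\<forall>c :: real. c > 2 / 7 \<longrightarrow>
        (\<exists>(p :: nat) (s :: nat) B as. prime p \<and> s \<ge> 1 \<and>
           finite B \<and> B \<subseteq> nonzero_elems (Zp_power p s) \<and>
           distinct as \<and> set as = B \<and>
           real (max_sum_free_set (Zp_power p s) B) < c * real (card B) \<and>
           real (max_sum_free_seq (Zp_power p s) as) < c * real (length as)))"
proof (intro conjI allI impI; (elim conjE)?)
  fix c :: real
  assume "c > 2 / 7"
  then obtain s as where as: "s \<ge> 1" "distinct as" "set as = nonzero_elems (Zp_power 7 s)"
    and less: "real (max_sum_free_set (Zp_power 7 s) (set as)) < c * real (length as)"
    by (rule two_sevenths_best_possible)
  have "real (max_sum_free_seq (Zp_power 7 s) as) < c * real (length as)"
    using max_sum_free_seq_distinct_le[OF as(2), of "Zp_power 7 s"] less by linarith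
  moreover have "prime (7 :: nat)" by simp
  ultimately show "\<exists>(p :: nat) (s :: nat) B as. prime p \<and> s \<ge> 1 \<and>
           finite B \<and> B \<subseteq> nonzero_elems (Zp_power p s) \<and>
           distinct as \<and> set as = B \<and>
           real (max_sum_free_set (Zp_power p s) B) < c * real (card B) \<and>
           real (max_sum_free_seq (Zp_power p s) as) < c * real (length as)"
    using as less by (metis List.finite_set distinct_card order_refl)
qed (rule sum_free_set_lower_bound sum_free_seq_lower_bound; assumption)+

end
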